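(* For every integer $m\geq 4$, every graph with chromatic number at least $m+1$ has a $3$-connected subgraph with chromatic number at least $m$. In particular (since a fragile graph has no 3-connected subgraph), every fragile graph is $4$-colourable.
   Context: All graphs are finite and simple. A graph is $k$-connected if it has at least $k+1$ vertices and no vertex cutset with at most $k-1$ vertices. A graph is fragile if it has no $3$-connected subgraph. *)

theory Defs
  imports Main
begin

text \<open>A finite simple graph: finite vertex set V, edge set E of ordered pairs
  that is symmetric and irreflexive, with both endpoints in V.\<close>
definition graph :: "'a set \<Rightarrow> ('a \<times> 'a) set \<Rightarrow> bool" where
  "graph V E \<longleftrightarrow> finite V \<and> E \<subseteq> V \<times> V \<and> sym E \<and> irrefl E"

definition subgraph :: "'a set \<Rightarrow> ('a \<times> 'a) set \<Rightarrow> 'a set \<Rightarrow> ('a \<times> 'a) set \<Rightarrow> bool" where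
  "subgraph V' E' V E \<longleftrightarrow> graph V' E' \<and> V' \<subseteq> V \<and> E' \<subseteq> E"

text \<open>Proper colourings with colours from {0..<k}.\<close>
definition colourable :: "'a set \<Rightarrow> ('a \<times> 'a) set \<Rightarrow> nat \<Rightarrow> bool" where
  "colourable V E k \<longleftrightarrow> (\<exists>c :: 'a \<Rightarrow> nat. (\<forall>v\<in>V. c v < k) \<and> (\<forall>(u,v)\<in>E. c u \<noteq> c v))"

definition chromatic_number :: "'a set \<Rightarrow> ('a \<times> 'a) set \<Rightarrow> nat" where
  "chromatic_number V E = (LEAST k. colourable V E k)"

text \<open>Connectedness of the graph (V, E) (edges restricted to V).\<close>
definition connected_graph :: "'a set \<Rightarrow> ('a \<times> 'a) set \<Rightarrow> bool" where
  "connected_graph V E \<longleftrightarrow> (\<forall>u\<in>V. \<forall>v\<in>V. (u, v) \<in> (E \<inter> (V \<times> V))\<^sup>*)"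

text \<open>Deleting a vertex set S.\<close>
definition vertex_cutset :: "'a set \<Rightarrow> ('a \<times> 'a) set \<Rightarrow> 'a set \<Rightarrow> bool" where
  "vertex_cutset V E S \<longleftrightarrow> S \<subseteq> V \<and> \<not> connected_graph (V - S) E"

definition k_connected :: "nat \<Rightarrow> 'a set \<Rightarrow> ('a \<times> 'a) set \<Rightarrow> bool" where
  "k_connected k V E \<longleftrightarrow> card V \<ge> k + 1 \<and>
     (\<forall>S. vertex_cutset V E S \<longrightarrow> \<not> card S \<le> k - 1)"

definition fragile :: "'a set \<Rightarrow> ('a \<times> 'a) set \<Rightarrow> bool" where
  "fragile V E \<longleftrightarrow> \<not> (\<exists>V' E'. subgraph V' E' V E \<and> k_connected 3 V' E')"

end

theory Submission
  imports Defs
begin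

text \<open>If a graph contains no \<open>3\<close>-connected subgraph with chromatic number at least \<open>m\<close>, then not only
  is it \<open>m\<close>-colourable, but it satisfies three properties that can be carried through an induction
  over separations of order two: two nonadjacent vertices can get the same colour; a vertex can
  avoid the colours of two others; and on a stable triple a colouring can use exactly two colours.
  If the graph is \<open>(m - 1)\<close>-colourable, in particular if it is \<open>3\<close>-connected, all three hold by
  recolouring a stable set with the spare colour. Otherwise the graph is the union of \<open>A\<close> and
  \<open>B\<close> meeting in two vertices \<open>x\<close>, \<open>y\<close>, and the properties of \<open>A\<close> and \<open>B\<close> provide
  colourings that agree on \<open>x\<close>, \<open>y\<close> after a permutation of the colours; the only obstruction
  is a copy of \<open>K\<^sub>4\<close> when \<open>m = 4\<close>, which is itself a forbidden \<open>3\<close>-connected subgraph.\<close>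

section \<open>Colourings and flexible vertex sets\<close>

text \<open>Graphs are the induced subgraphs \<open>E[W]\<close> of one fixed ambient edge set \<open>E\<close>.\<close>

definition colouring :: "('a \<times> 'a) set \<Rightarrow> nat \<Rightarrow> 'a set \<Rightarrow> ('a \<Rightarrow> nat) \<Rightarrow> bool" where
  "colouring E m W f \<longleftrightarrow> (\<forall>v\<in>W. f v < m) \<and> (\<forall>u\<in>W. \<forall>v\<in>W. (u, v) \<in> E \<longrightarrow> f u \<noteq> f v)"

definition two_valued :: "('a \<Rightarrow> nat) \<Rightarrow> 'a \<Rightarrow> 'a \<Rightarrow> 'a \<Rightarrow> bool" where
  "two_valued f p q r \<longleftrightarrow>
     f p = f q \<and> f r \<noteq> f p \<or> f p = f r \<and> f q \<noteq> f p \<or> f q = f r \<and> f p \<noteq> f q"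

text \<open>Coincidences are allowed on purpose: \<open>u = v\<close> in the first clause yields a
  plain colouring when there is no loop at \<open>u\<close>, and \<open>q = r\<close> in the second
  yields a colouring separating two given vertices, adjacent or not.\<close>

definition flexible :: "('a \<times> 'a) set \<Rightarrow> nat \<Rightarrow> 'a set \<Rightarrow> bool" where
  "flexible E m W \<longleftrightarrow>
     (\<forall>u\<in>W. \<forall>v\<in>W. (u, v) \<notin> E \<longrightarrow> (\<exists>f. colouring E m W f \<and> f u = f v)) \<and>
     (\<forall>u\<in>W. \<forall>q\<in>W. \<forall>r\<in>W. u \<noteq> q \<and> u \<noteq> r \<longrightarrow>
        (\<exists>f. colouring E m W f \<and> f u \<noteq> f q \<and> f u \<noteq> f r)) \<and>
     (\<forall>p\<in>W. \<forall>q\<in>W. \<forall>r\<in>W. distinct [p, q, r] \<and> (p, q) \<notin> E \<and> (p, r) \<notin> E \<and> (q, r) \<notin> E \<longrightarrow>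
        (\<exists>f. colouring E m W f \<and> two_valued f p q r))"

lemma colouring_less: "colouring E m W f \<Longrightarrow> v \<in> W \<Longrightarrow> f v < m"
  by (auto simp: colouring_def)

lemma colouring_neq: "colouring E m W f \<Longrightarrow> u \<in> W \<Longrightarrow> v \<in> W \<Longrightarrow> (u, v) \<in> E \<Longrightarrow> f u \<noteq> f v"
  by (auto simp: colouring_def)

lemma flexible_eq:
  assumes "flexible E m W" "u \<in> W" "v \<in> W" "(u, v) \<notin> E"
  obtains f where "colouring E m W f" "f u = f v"
  using assms unfolding flexible_def by blast

lemma flexible_neq:
  assumes "flexible E m W" "u \<in> W" "q \<in> W" "r \<in> W" "u \<noteq> q" "u \<noteq> r"
  obtains f where "colouring E m W f" "f u \<noteq> f q" "f u \<noteq> f r"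
  using assms unfolding flexible_def by blast

lemma flexible_two_valued:
  assumes "flexible E m W" "p \<in> W" "q \<in> W" "r \<in> W" "distinct [p, q, r]"
    "(p, q) \<notin> E" "(p, r) \<notin> E" "(q, r) \<notin> E"
  obtains f where "colouring E m W f" "two_valued f p q r"
  using assms unfolding flexible_def by blast

lemma two_valued_perm:
  "two_valued f p q r \<Longrightarrow> two_valued f q p r"
  "two_valued f p q r \<Longrightarrow> two_valued f p r q"
  unfolding two_valued_def by metis+

section \<open>Spare colours and recolouring\<close>

lemma fresh_colour:
  assumes "finite K" "card K < m"
  obtains k :: nat where "k < m" "k \<notin> K"
proof -
  have "\<not> {..<m} \<subseteq> K"
    using card_mono[OF assms(1), of "{..<m}"] assms(2) by auto
  then show ?thesis using that by blast
qed

lemma fresh_colour3: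
  assumes "4 \<le> (m::nat)"
  obtains k where "k < m" "k \<noteq> a" "k \<noteq> b" "k \<noteq> c"
proof -
  have "card {a, b, c} < m" using assms card_insert_le_m1[of 3 "{b, c}" a] card_insert_le_m1[of 2 "{c}" b] by simp
  then show ?thesis using that fresh_colour[of "{a, b, c}" m] by auto
qed

text \<open>The colours outside \<open>S\<close> and those outside its image are equally many, so
  they can be matched arbitrarily. This allows a colouring to be renamed with prescribed values on a
  few colours.\<close>

lemma permutation_extending:
  fixes m :: nat
  assumes "inj_on g S" "S \<subseteq> {..<m}" "g ` S \<subseteq> {..<m}"
  obtains h where "inj_on h {..<m}" "h ` {..<m} = {..<m}" "\<And>s. s \<in> S \<Longrightarrow> h s = g s"
proof -
  have fin: "finite S" using assms(2) finite_subset by blast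
  have "card ({..<m} - S) = card ({..<m} - g ` S)"
    using assms fin by (simp add: card_Diff_subset card_image)
  then obtain g' where g': "bij_betw g' ({..<m} - S) ({..<m} - g ` S)"
    using finite_same_card_bij by (metis finite_Diff finite_lessThan)
  define h where "h s = (if s \<in> S then g s else g' s)" for s
  have "bij_betw h S (g ` S)"
    using assms(1) by (auto simp: h_def bij_betw_def inj_on_def)
  moreover have "bij_betw h ({..<m} - S) ({..<m} - g ` S)"
    using g' by (rule bij_betw_cong[THEN iffD1, rotated]) (auto simp: h_def)
  ultimately have "bij_betw h (S \<union> ({..<m} - S)) (g ` S \<union> ({..<m} - g ` S))"
    by (rule bij_betw_combine) auto
  then have "bij_betw h {..<m} {..<m}"
    using assms by (simp add: Un_absorb1)
  then show ?thesis using that[of h] by (auto simp: bij_betw_def h_def)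
qed

lemma flexible_if_fewer_colours:
  assumes "sym E" "irrefl E" "0 < m" "colouring E (m - 1) W f"
  shows "flexible E m W"
proof -
  have less: "f v < m - 1" if "v \<in> W" for v
    using assms(4) that by (rule colouring_less)
  \<comment> \<open>The colour \<open>m - 1\<close> does not occur under \<open>f\<close>, so it can
    be placed on any stable \<open>T\<close>: \<open>{u, v}\<close> for equality, \<open>{u}\<close>
    for avoidance, and \<open>{p, q}\<close> for two values, with \<open>r\<close> keeping an old
    colour.\<close>
  have recolour: "colouring E m W (\<lambda>v. if v \<in> T then m - 1 else f v)"
    if T: "\<forall>u\<in>T. \<forall>v\<in>T. (u, v) \<notin> E" for T
    unfolding colouring_def
  proof (intro conjI ballI impI)
    fix v assume "v \<in> W"
    then show "(if v \<in> T then m - 1 else f v) < m"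
      using less[of v] assms(3) by auto
  next
    fix u v assume uv: "u \<in> W" "v \<in> W" "(u, v) \<in> E"
    then have "f u \<noteq> f v" using assms(4) by (rule colouring_neq[rotated])
    then show "(if u \<in> T then m - 1 else f u) \<noteq> (if v \<in> T then m - 1 else f v)"
      using T uv less[of u] less[of v] by auto
  qed
  have irr: "(v, v) \<notin> E" for v using assms(2) by (simp add: irrefl_def)
  have symm: "(v, u) \<notin> E" if "(u, v) \<notin> E" for u v using assms(1) that by (meson symD)
  show ?thesis
    unfolding flexible_def
  proof (intro conjI ballI impI)
    fix u v assume "u \<in> W" "v \<in> W" "(u, v) \<notin> E"
    then show "\<exists>f. colouring E m W f \<and> f u = f v"
      using recolour[of "{u, v}"] irr symm[of u v]
      by (intro exI[of _ "\<lambda>w. if w \<in> {u, v} then m - 1 else f w"]) auto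
  next
    fix u q r assume *: "u \<in> W" "q \<in> W" "r \<in> W" "u \<noteq> q \<and> u \<noteq> r"
    show "\<exists>f. colouring E m W f \<and> f u \<noteq> f q \<and> f u \<noteq> f r"
      using recolour[of "{u}"] irr less[of q] less[of r] *
      by (intro exI[of _ "\<lambda>w. if w \<in> {u} then m - 1 else f w"]) auto
  next
    fix p q r
    assume *: "p \<in> W" "q \<in> W" "r \<in> W"
      "distinct [p, q, r] \<and> (p, q) \<notin> E \<and> (p, r) \<notin> E \<and> (q, r) \<notin> E"
    show "\<exists>f. colouring E m W f \<and> two_valued f p q r"
      using recolour[of "{p, q}"] irr symm[of p q] less[of r] *
      by (intro exI[of _ "\<lambda>w. if w \<in> {p, q} then m - 1 else f w"]) (auto simp: two_valued_def)
  qed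
qed

section \<open>Gluing colourings across a separation of order two\<close>

locale separation =
  fixes E :: "('a \<times> 'a) set" and m :: nat and A B :: "'a set" and x y :: 'a
  assumes sym_E: "sym E" and irrefl_E: "irrefl E" and m: "4 \<le> m"
    and xy: "x \<noteq> y" and inter: "A \<inter> B = {x, y}"
    and no_edge: "\<And>u v. u \<in> A - B \<Longrightarrow> v \<in> B - A \<Longrightarrow> (u, v) \<notin> E"
begin

lemma swap_sides: "separation E m B A x y"
proof
  show "(u, v) \<notin> E" if "u \<in> B - A" "v \<in> A - B" for u v
    using no_edge[OF that(2,1)] symD[OF sym_E] by blast
qed (use sym_E irrefl_E m xy inter in auto)

lemma cut_in: "x \<in> A" "y \<in> A" "x \<in> B" "y \<in> B"
  using inter by auto

text \<open>The three equivalences say that \<open>e x\<close>, \<open>e y\<close>,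
  \<open>e z\<close> coincide exactly as \<open>d x\<close>, \<open>d y\<close>, \<open>k\<close>
  do, so sending the former to the latter is well defined and injective and extends to a permutation
  of the colours. The vertex \<open>z\<close> prescribes one colour on the far side besides those of
  the cut.\<close>

lemma glue:
  assumes d: "colouring E m A d" and e: "colouring E m B e"
    and "e x = e y \<longleftrightarrow> d x = d y"
    and "z \<in> B" "k < m" "e z = e x \<longleftrightarrow> k = d x" "e z = e y \<longleftrightarrow> k = d y"
  obtains f where "colouring E m (A \<union> B) f" "\<And>v. v \<in> A \<Longrightarrow> f v = d v" "f z = k"
proof -
  define g where "g = (\<lambda>i. if i = e x then d x else if i = e y then d y else k)"
  have g: "g (e x) = d x" "g (e y) = d y" "g (e z) = k"
    using assms by (auto simp: g_def)
  have "inj_on g {e x, e y, e z}"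
    using assms(3,6,7) unfolding inj_on_def ball_simps g by metis
  moreover have "{e x, e y, e z} \<subseteq> {..<m}"
    using colouring_less[OF e] cut_in \<open>z \<in> B\<close> by auto
  moreover have "g ` {e x, e y, e z} \<subseteq> {..<m}"
    using colouring_less[OF d] cut_in g \<open>k < m\<close> by auto
  ultimately obtain h where h: "inj_on h {..<m}" "h ` {..<m} = {..<m}"
    "\<And>s. s \<in> {e x, e y, e z} \<Longrightarrow> h s = g s"
    by (rule permutation_extending) blast
  have cut: "v = x \<or> v = y" if "v \<in> A" "v \<in> B" for v using inter that by blast
  define f where "f v = (if v \<in> A then d v else h (e v))" for v
  have fB: "f v = h (e v)" if "v \<in> B" for v
    using cut[OF _ that] h(3) g by (auto simp: f_def)
  have "colouring E m (A \<union> B) f"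
    unfolding colouring_def
  proof (intro conjI ballI impI)
    fix v assume v: "v \<in> A \<union> B"
    show "f v < m"
    proof (cases "v \<in> A")
      case True
      then show ?thesis using colouring_less[OF d] by (simp add: f_def)
    next
      case False
      then have "e v \<in> {..<m}" using v colouring_less[OF e] by auto
      then show ?thesis using False h(2) by (auto simp: f_def)
    qed
  next
    fix u v assume uv: "u \<in> A \<union> B" "v \<in> A \<union> B" "(u, v) \<in> E"
    then have "(v, u) \<in> E" using sym_E by (meson symD)
    then have "u \<in> A \<and> v \<in> A \<or> u \<in> B \<and> v \<in> B"
      using uv no_edge by blast
    then show "f u \<noteq> f v"
    proof
      assume "u \<in> A \<and> v \<in> A"
      then show ?thesis using colouring_neq[OF d] uv by (simp add: f_def)
    next
      assume *: "u \<in> B \<and> v \<in> B"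
      then have "e u \<noteq> e v" using colouring_neq[OF e] uv by blast
      moreover have "e u \<in> {..<m}" "e v \<in> {..<m}" using * colouring_less[OF e] by auto
      ultimately show ?thesis using h(1) fB * by (metis inj_onD)
    qed
  qed
  moreover have "f v = d v" if "v \<in> A" for v using that by (simp add: f_def)
  moreover have "f z = k" using fB[OF \<open>z \<in> B\<close>] h(3) g by simp
  ultimately show ?thesis using that by blast
qed

lemma glue':
  assumes d: "colouring E m A d" and e: "colouring E m B e"
    and "e x = e y \<longleftrightarrow> d x = d y"
  obtains f where "colouring E m (A \<union> B) f" "\<And>v. v \<in> A \<Longrightarrow> f v = d v"
proof -
  have "d x < m" using colouring_less[OF d] cut_in by blast
  then show ?thesis
    using glue[OF assms cut_in(3), of "d x"] assms(3) that by blast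
qed

text \<open>For gluing it only matters whether \<open>d\<close> agrees on \<open>x\<close> and
  \<open>y\<close>. Flexibility of \<open>B\<close> supplies both patterns: equality when
  \<open>x\<close> and \<open>y\<close> are nonadjacent, difference always.\<close>

lemma extend:
  assumes B: "flexible E m B" and d: "colouring E m A d"
  obtains f where "colouring E m (A \<union> B) f" "\<And>v. v \<in> A \<Longrightarrow> f v = d v"
proof (cases "d x = d y")
  case True
  then have "(x, y) \<notin> E" using colouring_neq[OF d] cut_in by blast
  then obtain e where "colouring E m B e" "e x = e y"
    using flexible_eq[OF B] cut_in by metis
  then show ?thesis using glue'[OF d] True that by blast
next
  case False
  obtain e where "colouring E m B e" "e x \<noteq> e y"
    using flexible_neq[OF B, of x y y] cut_in xy by metis
  then show ?thesis using glue'[OF d] False that by blast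
qed

section \<open>Carrying the three properties across a separation\<close>

text \<open>Handles the mismatch in which \<open>d\<close> separates the cut vertices and
  \<open>e\<close> merges them: the two cannot be glued, so at least one side is recoloured.\<close>

lemma eq_across_aux:
  assumes A: "flexible E m A" and B: "flexible E m B" and u: "u \<in> A - B" and v: "v \<in> B - A"
    and d: "colouring E m A d" "d u \<noteq> d x" "d u \<noteq> d y" "d x \<noteq> d y"
    and e: "colouring E m B e" "e v \<noteq> e x" "e v \<noteq> e y" "e x = e y"
  shows "\<exists>f. colouring E m (A \<union> B) f \<and> f u = f v"
proof -
  have join: ?thesis
    if "colouring E m A d" "colouring E m B e" "e x = e y \<longleftrightarrow> d x = d y"
      "e v = e x \<longleftrightarrow> d u = d x" "e v = e y \<longleftrightarrow> d u = d y" for d e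
    using glue[OF that(1,2,3), of v "d u"] that u v colouring_less[OF that(1)] by (metis DiffD1)
  show ?thesis
  proof (cases "\<exists>d'. colouring E m A d' \<and> d' x = d' y \<and> d' u \<noteq> d' x")
    case True
    then show ?thesis using join e by metis
  next
    \<comment> \<open>Every colouring of \<open>A\<close> merging \<open>x\<close> and
      \<open>y\<close> now gives \<open>u\<close> the same colour. Such a colouring exists, so
      \<open>u\<close>, \<open>x\<close>, \<open>y\<close> are stable, and a two-valued colouring of
      them must match \<open>u\<close> with exactly one cut vertex.\<close>
    case no: False
    have xy_E: "(x, y) \<notin> E" using colouring_neq[OF e(1)] cut_in e by blast
    obtain d0 where d0: "colouring E m A d0" "d0 x = d0 y"
      using flexible_eq[OF A] cut_in xy_E by metis
    then have "d0 u = d0 x" "d0 u = d0 y" using no by metis+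
    then have stable: "(u, x) \<notin> E" "(u, y) \<notin> E"
      using colouring_neq[OF d0(1)] u cut_in by blast+
    moreover have "distinct [u, x, y]" using u xy cut_in by auto
    ultimately obtain d' where d': "colouring E m A d'" "two_valued d' u x y"
      using flexible_two_valued[OF A, of u x y] u cut_in xy_E by blast
    \<comment> \<open>Here \<open>a\<close> is the cut vertex matched with \<open>u\<close>. Under
      \<open>e'\<close>, either \<open>v\<close> matches \<open>a\<close>, as \<open>u\<close> does
      under \<open>d'\<close>, or \<open>v\<close> avoids both cut vertices, as \<open>u\<close>
      does under \<open>d\<close>.\<close>
    have key: ?thesis if ab: "{a, b} = {x, y}" "d' u = d' a" "d' b \<noteq> d' u" for a b
    proof -
      have "b \<in> B" "a \<in> B" "b \<noteq> v" "a \<noteq> b" using ab cut_in v xy by (auto simp: doubleton_eq_iff)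
      then obtain e' where e': "colouring E m B e'" "e' b \<noteq> e' v" "e' b \<noteq> e' a"
        using flexible_neq[OF B, of b v a] v by blast
      show ?thesis
      proof (cases "e' v = e' a")
        case True
        then show ?thesis using join[OF d'(1) e'(1)] e' ab by (auto simp: doubleton_eq_iff)
      next
        case False
        then show ?thesis using join[OF d(1) e'(1)] d e' ab by (auto simp: doubleton_eq_iff)
      qed
    qed
    show ?thesis
      using d'(2) key[of x y] key[of y x] no d'(1) unfolding two_valued_def by (metis insert_commute)
  qed
qed

text \<open>Choose colourings in which \<open>u\<close> and \<open>v\<close> avoid the colours of
  the cut. If they agree on whether \<open>x\<close> and \<open>y\<close> coincide, \<open>v\<close>
  can receive the colour of \<open>u\<close>; the two mismatches are mirror images.\<close>

lemma eq_across:
  assumes A: "flexible E m A" and B: "flexible E m B" and u: "u \<in> A - B" and v: "v \<in> B - A"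
  shows "\<exists>f. colouring E m (A \<union> B) f \<and> f u = f v"
proof -
  obtain d where d: "colouring E m A d" "d u \<noteq> d x" "d u \<noteq> d y"
    using flexible_neq[OF A, of u x y] u cut_in by blast
  obtain e where e: "colouring E m B e" "e v \<noteq> e x" "e v \<noteq> e y"
    using flexible_neq[OF B, of v x y] v cut_in by blast
  consider "e x = e y \<longleftrightarrow> d x = d y" | "d x \<noteq> d y" "e x = e y" | "d x = d y" "e x \<noteq> e y" by blast
  then show ?thesis
  proof cases
    case 1
    then show ?thesis
      using glue[OF d(1) e(1), of v "d u"] d e u v colouring_less[OF d(1)] by (metis DiffD1)
  next
    case 2
    then show ?thesis using eq_across_aux[OF A B u v d(1-3) _ e(1-3)] by blast
  next
    case 3
    then show ?thesis
      using separation.eq_across_aux[OF swap_sides B A v u e(1-3) _ d(1-3)] by (metis Un_commute)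
  qed
qed

text \<open>A colour missing from \<open>q\<close>, \<open>r\<close>, \<open>x\<close>,
  \<open>y\<close> can be lacking only if \<open>m = 4\<close> and these four have different
  colours. If the cut is adjacent, \<open>no_K4\<close> or a merged pair prevents this; otherwise
  \<open>u\<close> may be able to share a cut colour.\<close>

lemma neq_pair_across:
  assumes A: "flexible E m A" and B: "flexible E m B"
    and u: "u \<in> B - A" and q: "q \<in> A" and r: "r \<in> A"
    and no_K4: "\<lbrakk>(q, r) \<in> E; (q, x) \<in> E; (q, y) \<in> E; (r, x) \<in> E; (r, y) \<in> E; (x, y) \<in> E\<rbrakk> \<Longrightarrow> 5 \<le> m"
  shows "\<exists>f. colouring E m (A \<union> B) f \<and> f u \<noteq> f q \<and> f u \<noteq> f r"
proof -
  have join: ?thesis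
    if "colouring E m A d" "colouring E m B e" "e x = e y \<longleftrightarrow> d x = d y" "k < m"
      "e u = e x \<longleftrightarrow> k = d x" "e u = e y \<longleftrightarrow> k = d y" "k \<noteq> d q" "k \<noteq> d r" for d e k
    using glue[OF that(1,2,3) _ that(4), of u] that u q r by (metis DiffD1)
  obtain e where e: "colouring E m B e" "e u \<noteq> e x" "e u \<noteq> e y"
    using flexible_neq[OF B, of u x y] u cut_in by blast
  show ?thesis
  proof (cases "(x, y) \<in> E")
    case True
    have exy: "e x \<noteq> e y" using colouring_neq[OF e(1)] cut_in True by blast
    have fresh: ?thesis if d: "colouring E m A d"
      and k: "k < m" "k \<noteq> d q" "k \<noteq> d r" "k \<noteq> d x" "k \<noteq> d y" for d k
    proof -
      have "d x \<noteq> d y" using colouring_neq[OF d] cut_in True by blast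
      then show ?thesis using join[OF d e(1) _ k(1)] e exy k by simp
    qed
    \<comment> \<open>Merging a nonadjacent pair leaves at most three colours on \<open>q\<close>,
      \<open>r\<close>, \<open>x\<close>, \<open>y\<close>. Coinciding vertices count as
      nonadjacent, since \<open>E\<close> has no loops.\<close>
    have nonadj: ?thesis if ab: "(a, b) \<notin> E" "{a, b, s, t} = {q, r, x, y}" for a b s t
    proof -
      have "{q, r, x, y} \<subseteq> A" using q r cut_in by blast
      then have "a \<in> A" "b \<in> A" using ab(2) by blast+
      then obtain d where d: "colouring E m A d" "d a = d b"
        using flexible_eq[OF A] ab by metis
      obtain k where k: "k < m" "k \<noteq> d a" "k \<noteq> d s" "k \<noteq> d t"
        using fresh_colour3[OF m] by metis
      have "k \<noteq> d c" if "c \<in> {a, b, s, t}" for c using that k d by auto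
      then show ?thesis using fresh[OF d(1) k(1)] ab(2) by auto
    qed
    show ?thesis
    proof (cases "(q, r) \<in> E \<and> (q, x) \<in> E \<and> (q, y) \<in> E \<and> (r, x) \<in> E \<and> (r, y) \<in> E")
      case False
      then show ?thesis
        using nonadj[of q r x y] nonadj[of q x r y] nonadj[of q y r x]
          nonadj[of r x q y] nonadj[of r y q x] by blast
    next
      case K4: True
      obtain d where d: "colouring E m A d"
        using flexible_neq[OF A, of x y y] xy cut_in by blast
      have "card {d q, d r, d x, d y} \<le> 4"
        using card_length[of "[d q, d r, d x, d y]"] by simp
      also have "4 < m" using no_K4 K4 True by simp
      finally obtain k where "k < m" "k \<notin> {d q, d r, d x, d y}"
        using fresh_colour by (metis finite.emptyI finite.insertI)
      then show ?thesis using fresh[OF d] by blast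
    qed
  next
    case xy_E: False
    show ?thesis
    proof (cases "\<exists>e'. colouring E m B e' \<and> e' x = e' y \<and> e' u \<noteq> e' x")
      case True
      then obtain e' where e': "colouring E m B e'" "e' x = e' y" "e' u \<noteq> e' x" by blast
      obtain d where d: "colouring E m A d" "d x = d y"
        using flexible_eq[OF A] cut_in xy_E by metis
      obtain k where "k < m" "k \<noteq> d x" "k \<noteq> d q" "k \<noteq> d r"
        using fresh_colour3[OF m] by metis
      then show ?thesis using join[OF d(1) e'(1)] d e' by metis
    next
      \<comment> \<open>As for equality across the cut, \<open>u\<close>, \<open>x\<close>,
        \<open>y\<close> turn out to be stable, and a two-valued colouring matches \<open>u\<close>
        with exactly one cut vertex.\<close>
      case no: False
      then have exy: "e x \<noteq> e y" using e by blast
      obtain e0 where e0: "colouring E m B e0" "e0 x = e0 y"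
        using flexible_eq[OF B] cut_in xy_E by metis
      then have "e0 u = e0 x" "e0 u = e0 y" using no by metis+
      then have stable: "(u, x) \<notin> E" "(u, y) \<notin> E"
        using colouring_neq[OF e0(1)] u cut_in by blast+
      moreover have "distinct [u, x, y]" using u xy cut_in by auto
      ultimately obtain e' where e': "colouring E m B e'" "two_valued e' u x y"
        using flexible_two_valued[OF B, of u x y] u cut_in xy_E by blast
      obtain d where d: "colouring E m A d" "d x \<noteq> d y"
        using flexible_neq[OF A, of x y y] xy cut_in by blast
      have less: "d x < m" "d y < m" using colouring_less[OF d(1)] cut_in by auto
      show ?thesis
      proof (cases "\<exists>k<m. k \<noteq> d q \<and> k \<noteq> d r \<and> k \<noteq> d x \<and> k \<noteq> d y")
        case True
        then show ?thesis using join[OF d(1) e(1)] d e exy by metis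
      next
        \<comment> \<open>All \<open>m \<ge> 4\<close> colours occur on \<open>q\<close>,
          \<open>r\<close>, \<open>x\<close>, \<open>y\<close>, so these four are coloured
          differently, and \<open>u\<close> can take the colour of whichever cut vertex
          \<open>e'\<close> matches it with.\<close>
        case False
        then have "d x \<noteq> d q" "d x \<noteq> d r" "d y \<noteq> d q" "d y \<noteq> d r"
          using fresh_colour3[OF m] by metis+
        moreover have "e' u = e' x \<and> e' u \<noteq> e' y \<or> e' u = e' y \<and> e' u \<noteq> e' x"
          using e' no unfolding two_valued_def by metis
        ultimately show ?thesis
          using join[OF d(1) e'(1), of "d x"] join[OF d(1) e'(1), of "d y"] d less by metis
      qed
    qed
  qed
qed

text \<open>Beyond the cut, \<open>q\<close> receives \<open>d x\<close>, \<open>d y\<close> or a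
  fresh colour. The colourings are chosen so that this is never the colour of
  \<open>u\<close>.\<close>

lemma neq_split_across:
  assumes A: "flexible E m A" and B: "flexible E m B"
    and u: "u \<in> A" and q: "q \<in> B - A" and r: "r \<in> A" and ur: "u \<noteq> r"
  shows "\<exists>f. colouring E m (A \<union> B) f \<and> f u \<noteq> f q \<and> f u \<noteq> f r"
proof -
  have join: ?thesis
    if "colouring E m A d" "colouring E m B e" "e x = e y \<longleftrightarrow> d x = d y" "k < m"
      "e q = e x \<longleftrightarrow> k = d x" "e q = e y \<longleftrightarrow> k = d y" "d u \<noteq> k" "d u \<noteq> d r" for d e k
    using glue[OF that(1,2,3) _ that(4), of q] that u q r by (metis DiffD1)
  \<comment> \<open>If \<open>u\<close> is itself a cut vertex, both sides can separate it from the
    other one, \<open>b\<close>, so the patterns match; \<open>q\<close> then takes the colour of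
    \<open>b\<close> or a fresh one.\<close>
  have in_cut: ?thesis if ab: "{a, b} = {x, y}" "u = a" for a b
  proof -
    have "b \<in> A" "b \<in> B" "a \<noteq> b" "a \<noteq> q" "a \<in> B" using ab cut_in xy q by (auto simp: doubleton_eq_iff)
    then obtain d e where d: "colouring E m A d" "d a \<noteq> d r" "d a \<noteq> d b"
      and e: "colouring E m B e" "e a \<noteq> e q" "e a \<noteq> e b"
      using flexible_neq[OF A, of a r b] flexible_neq[OF B, of a q b] u q r ur ab(2)
      by (metis DiffD1)
    obtain f where f: "colouring E m A f" "f x \<noteq> f y" "f u \<noteq> f r"
      using d ab by (auto simp: doubleton_eq_iff)
    obtain k where k: "k < m" "k \<noteq> d x" "k \<noteq> d y"
      using fresh_colour3[OF m] by metis
    have "d b < m" using colouring_less[OF d(1)] \<open>b \<in> A\<close> by blast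
    then show ?thesis
      using join[OF d(1) e(1), of "d b"] join[OF d(1) e(1), of k] d e k ab
      by (cases "e q = e b") (auto simp: doubleton_eq_iff)
  qed
  show ?thesis
  proof (cases "u = x \<or> u = y")
    case True
    then show ?thesis using in_cut[of x y] in_cut[of y x] by blast
  next
    case False
    then obtain d where d: "colouring E m A d" "d u \<noteq> d r" "d u \<noteq> d x"
      using flexible_neq[OF A, of u r x] u r ur cut_in by blast
    have less: "d x < m" "d y < m" using colouring_less[OF d(1)] cut_in by auto
    obtain k where k: "k < m" "k \<noteq> d u" "k \<noteq> d x" "k \<noteq> d y"
      using fresh_colour3[OF m] by metis
    \<comment> \<open>Since \<open>d u \<noteq> d x\<close>, the only danger is that
      \<open>q\<close> takes the colour of \<open>y\<close> while \<open>u\<close> has it too. In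
      the last case below, \<open>e\<close> separates \<open>y\<close> from \<open>q\<close> to
      exclude this.\<close>
    have free: ?thesis if e: "colouring E m B e" "e x = e y \<longleftrightarrow> d x = d y"
      "e q = e y \<longrightarrow> d u \<noteq> d y" for e
      using join[OF d(1) e(1,2), of "d x"] join[OF d(1) e(1,2), of "d y"]
        join[OF d(1) e(1,2), of k] less k d e by metis
    consider "d x = d y" | "d x \<noteq> d y" "d u \<noteq> d y" | "d x \<noteq> d y" "d u = d y" by blast
    then show ?thesis
    proof cases
      case 1
      then have "(x, y) \<notin> E" using colouring_neq[OF d(1)] cut_in by blast
      then obtain e where "colouring E m B e" "e x = e y"
        using flexible_eq[OF B] cut_in by metis
      then show ?thesis using free 1 d by metis
    next
      case 2
      obtain e where "colouring E m B e" "e x \<noteq> e y"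
        using flexible_neq[OF B, of x y y] cut_in xy by metis
      then show ?thesis using free 2 by metis
    next
      case 3
      have "y \<noteq> q" using q cut_in by blast
      then obtain e where "colouring E m B e" "e y \<noteq> e q" "e y \<noteq> e x"
        using flexible_neq[OF B, of y q x] cut_in xy q by (metis DiffD1)
      then show ?thesis using free 3 by metis
    qed
  qed
qed

text \<open>Start from a colouring of \<open>A\<close> merging \<open>p\<close> and \<open>q\<close>
  and try to keep \<open>z\<close> off their colour. Failure forces \<open>z\<close>,
  \<open>x\<close>, \<open>y\<close> to be stable, and then colourings separating \<open>x\<close>
  from \<open>y\<close> suffice.\<close>

lemma two_valued_across:
  assumes A: "flexible E m A" and B: "flexible E m B"
    and p: "p \<in> A" and q: "q \<in> A" and z: "z \<in> B - A" and pq: "(p, q) \<notin> E"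
  shows "\<exists>f. colouring E m (A \<union> B) f \<and> two_valued f p q z"
proof -
  have ne: "distinct [z, x, y]" using xy z cut_in by auto
  have join: ?thesis
    if d: "colouring E m A d" and e: "colouring E m B e" and xy: "e x = e y \<longleftrightarrow> d x = d y"
      and k: "k < m" "e z = e x \<longleftrightarrow> k = d x" "e z = e y \<longleftrightarrow> k = d y"
      and two: "d p = d q \<and> k \<noteq> d p \<or> d p = k \<and> d q \<noteq> k \<or> d q = k \<and> d p \<noteq> k" for d e k
  proof -
    obtain f where f: "colouring E m (A \<union> B) f" "\<And>v. v \<in> A \<Longrightarrow> f v = d v" "f z = k"
      using glue[OF d e xy _ k] z by blast
    have fd: "f p = d p" "f q = d q" using f(2) p q by blast+
    have "two_valued f p q z" using two unfolding two_valued_def fd f(3) by blast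
    then show ?thesis using f by blast
  qed
  obtain d where d: "colouring E m A d" "d p = d q"
    using flexible_eq[OF A p q pq] .
  have less: "d' x < m" "d' y < m" "d' p < m" "d' q < m" if "colouring E m A d'" for d'
    using colouring_less[OF that] p q cut_in by blast+
  obtain k where k: "k < m" "k \<noteq> d p" "k \<noteq> d x" "k \<noteq> d y"
    using fresh_colour3[OF m] by metis
  \<comment> \<open>A fresh colour for \<open>z\<close> is harmless; trouble comes only from a cut
    colour equal to \<open>d p\<close>.\<close>
  have avoid: ?thesis if "colouring E m B e" "e x = e y \<longleftrightarrow> d x = d y"
    "e z = e x \<longrightarrow> d x \<noteq> d p" "e z = e y \<longrightarrow> d y \<noteq> d p" for e
    using join[OF d(1) that(1,2), of k] join[OF d(1) that(1,2), of "d x"]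
      join[OF d(1) that(1,2), of "d y"] that less[OF d(1)] k d(2) by metis
  obtain e where e: "colouring E m B e" "e z \<noteq> e x" "e z \<noteq> e y"
    using flexible_neq[OF B, of z x y] z cut_in ne by auto
  show ?thesis
  proof (cases "d x = d y")
    case False
    \<comment> \<open>As \<open>d x \<noteq> d y\<close>, some cut vertex \<open>b\<close> differs
      in colour from \<open>p\<close>; \<open>e\<close> is chosen to keep \<open>z\<close> off the
      other one, \<open>a\<close>.\<close>
    have key: ?thesis if ab: "{a, b} = {x, y}" "d b \<noteq> d p" for a b
    proof -
      have "a \<in> B" "b \<in> B" "a \<noteq> b" "a \<noteq> z"
        using ab cut_in ne by (auto simp: doubleton_eq_iff)
      then obtain e where "colouring E m B e" "e a \<noteq> e z" "e a \<noteq> e b"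
        using flexible_neq[OF B, of a z b] z by blast
      then show ?thesis using avoid[of e] ab False by (auto simp: doubleton_eq_iff)
    qed
    show ?thesis using key[of x y] key[of y x] False by (metis insert_commute)
  next
    case dxy: True
    then have xy_E: "(x, y) \<notin> E" using colouring_neq[OF d(1)] cut_in by blast
    obtain e0 where e0: "colouring E m B e0" "e0 x = e0 y"
      using flexible_eq[OF B _ _ xy_E] cut_in by blast
    show ?thesis
    proof (cases "\<exists>e. colouring E m B e \<and> e x = e y \<and> (e z = e x \<longrightarrow> d x \<noteq> d p)")
      case True
      then show ?thesis using avoid dxy by metis
    next
      \<comment> \<open>Merging \<open>x\<close> and \<open>y\<close> in \<open>B\<close> now forces
        \<open>z\<close> onto their colour. Two ways of separating \<open>x\<close> from
        \<open>y\<close> remain: \<open>e\<close> keeps \<open>z\<close> off the cut colours, and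
        \<open>e1\<close> matches \<open>z\<close> with exactly one cut vertex.\<close>
      case no: False
      then have "e0 z = e0 x" "e0 z = e0 y" "e x \<noteq> e y" using e e0 by metis+
      then have "(z, x) \<notin> E" "(z, y) \<notin> E"
        using colouring_neq[OF e0(1)] z cut_in by blast+
      then obtain e1 where e1: "colouring E m B e1" "two_valued e1 z x y"
        using flexible_two_valued[OF B _ _ _ ne] z cut_in xy_E by blast
      obtain d1 where d1: "colouring E m A d1" "d1 x \<noteq> d1 y"
        using flexible_neq[OF A, of x y y] xy cut_in by blast
      obtain l where l: "l < m" "l \<noteq> d1 x" "l \<noteq> d1 y"
        using fresh_colour3[OF m] by metis
      have fresh: ?thesis if "l < m" "l \<noteq> d1 x" "l \<noteq> d1 y"
        "d1 p = d1 q \<and> l \<noteq> d1 p \<or> d1 p = l \<and> d1 q \<noteq> l \<or> d1 q = l \<and> d1 p \<noteq> l" for l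
        using join[OF d1(1) e(1), of l] that e \<open>e x \<noteq> e y\<close> d1(2) by blast
      have key: ?thesis if ab: "{a, b} = {x, y}" "e1 z = e1 a" "e1 z \<noteq> e1 b" for a b
      proof -
        have old: ?thesis if "d1 p = d1 q \<and> d1 a \<noteq> d1 p \<or> d1 p = d1 a \<and> d1 q \<noteq> d1 a \<or> d1 q = d1 a \<and> d1 p \<noteq> d1 a"
          using join[OF d1(1) e1(1), of "d1 a"] that ab d1 less[OF d1(1)]
          by (auto simp: doubleton_eq_iff)
        show ?thesis
        proof (cases "d1 p = d1 q")
          case True
          have "d1 a \<noteq> d1 p \<or> l \<noteq> d1 p" using l ab by (auto simp: doubleton_eq_iff)
          then show ?thesis using old fresh[OF l] True by blast
        next
          \<comment> \<open>If \<open>p\<close> or \<open>q\<close> has a colour outside the cut,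
            \<open>z\<close> copies it. Otherwise they carry the two cut colours, so one of them has
            the colour of \<open>a\<close>, and \<open>z\<close> takes that.\<close>
          case False
          consider "d1 p \<noteq> d1 x" "d1 p \<noteq> d1 y" | "d1 q \<noteq> d1 x" "d1 q \<noteq> d1 y"
            | "d1 p = d1 a" | "d1 q = d1 a"
            using False ab(1) by (metis doubleton_eq_iff)
          then show ?thesis
            using old fresh[of "d1 p"] fresh[of "d1 q"] less[OF d1(1)] False by cases metis+
        qed
      qed
      consider "e1 z = e1 x" "e1 z \<noteq> e1 y" | "e1 z = e1 y" "e1 z \<noteq> e1 x"
        using e1(2) no e1(1) unfolding two_valued_def by metis
      then show ?thesis
        by cases (use key[of x y] key[of y x] in blast)+
    qed
  qed
qed

text \<open>Vertices on a common side are handled by extending a colouring of that side; mixed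
  positions use the preceding lemmas or their mirror images. \<open>no_K4\<close> is applied to
  \<open>q\<close>, \<open>r\<close> and the two cut vertices.\<close>

lemma flexible_Un:
  assumes A: "flexible E m A" and B: "flexible E m B"
    and no_K4: "\<And>a b c d. \<lbrakk>{a, b, c, d} \<subseteq> A \<union> B; (a, b) \<in> E; (a, c) \<in> E; (a, d) \<in> E;
      (b, c) \<in> E; (b, d) \<in> E; (c, d) \<in> E\<rbrakk> \<Longrightarrow> 5 \<le> m"
  shows "flexible E m (A \<union> B)"
proof -
  interpret sw: separation E m B A x y by (rule swap_sides)
  note Un = Un_commute[of B A]
  have extendA: "\<exists>f. colouring E m (A \<union> B) f \<and> (\<forall>v\<in>A. f v = d v)" if "colouring E m A d" for d
    using extend[OF B that] by metis
  have extendB: "\<exists>f. colouring E m (A \<union> B) f \<and> (\<forall>v\<in>B. f v = d v)" if "colouring E m B d" for d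
    using sw.extend[OF A that] Un by metis
  show ?thesis
    unfolding flexible_def
  proof (intro conjI ballI impI)
    fix u v assume uv: "u \<in> A \<union> B" "v \<in> A \<union> B" "(u, v) \<notin> E"
    consider "u \<in> A" "v \<in> A" | "u \<in> B" "v \<in> B" | "u \<in> A - B" "v \<in> B - A" | "u \<in> B - A" "v \<in> A - B"
      using uv by blast
    then show "\<exists>f. colouring E m (A \<union> B) f \<and> f u = f v"
    proof cases
      case 1
      then show ?thesis using flexible_eq[OF A _ _ uv(3)] extendA by metis
    next
      case 2
      then show ?thesis using flexible_eq[OF B _ _ uv(3)] extendB by metis
    next
      case 3
      then show ?thesis using eq_across[OF A B] by blast
    next
      case 4
      then show ?thesis using sw.eq_across[OF B A] Un by simp
    qed
  next
    fix u q r assume uqr: "u \<in> A \<union> B" "q \<in> A \<union> B" "r \<in> A \<union> B" "u \<noteq> q \<and> u \<noteq> r"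
    have K4: "5 \<le> m" if "q \<in> C" "r \<in> C" "C \<subseteq> A \<union> B"
      "(q, r) \<in> E" "(q, x) \<in> E" "(q, y) \<in> E" "(r, x) \<in> E" "(r, y) \<in> E" "(x, y) \<in> E" for C
      using no_K4[of q r x y] that cut_in by blast
    consider "u \<in> A" "q \<in> A" "r \<in> A" | "u \<in> B" "q \<in> B" "r \<in> B"
      | "u \<in> B - A" "q \<in> A" "r \<in> A" | "u \<in> A - B" "q \<in> B" "r \<in> B"
      | "u \<in> A" "q \<in> B - A" "r \<in> A" | "u \<in> A" "r \<in> B - A" "q \<in> A"
      | "u \<in> B" "q \<in> A - B" "r \<in> B" | "u \<in> B" "r \<in> A - B" "q \<in> B"
      using uqr by blast
    then show "\<exists>f. colouring E m (A \<union> B) f \<and> f u \<noteq> f q \<and> f u \<noteq> f r"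
    proof cases
      case 1
      then show ?thesis using flexible_neq[OF A, of u q r] extendA uqr(4) by metis
    next
      case 2
      then show ?thesis using flexible_neq[OF B, of u q r] extendB uqr(4) by metis
    next
      case 3
      then show ?thesis using neq_pair_across[OF A B _ _ _ K4[of A]] by blast
    next
      case 4
      then show ?thesis using sw.neq_pair_across[OF B A _ _ _ K4[of B]] Un by auto
    next
      case 5
      then show ?thesis using neq_split_across[OF A B] uqr(4) by blast
    next
      case 6
      then show ?thesis using neq_split_across[OF A B] uqr(4) by blast
    next
      case 7
      then show ?thesis using sw.neq_split_across[OF B A, of u q r] Un uqr(4) by auto
    next
      case 8
      then show ?thesis using sw.neq_split_across[OF B A, of u r q] Un uqr(4) by auto
    qed
  next
    fix p q r assume pqr: "p \<in> A \<union> B" "q \<in> A \<union> B" "r \<in> A \<union> B"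
      and stable: "distinct [p, q, r] \<and> (p, q) \<notin> E \<and> (p, r) \<notin> E \<and> (q, r) \<notin> E"
    have across: "\<exists>f. colouring E m (A \<union> B) f \<and> two_valued f a b c"
      if "a \<in> A \<and> b \<in> A \<and> c \<in> B - A \<or> a \<in> B \<and> b \<in> B \<and> c \<in> A - B" "(a, b) \<notin> E" for a b c
      using that two_valued_across[OF A B, of a b c] sw.two_valued_across[OF B A, of a b c] Un by auto
    consider "p \<in> A" "q \<in> A" "r \<in> A" | "p \<in> B" "q \<in> B" "r \<in> B"
      | "p \<in> A \<and> q \<in> A \<and> r \<in> B - A \<or> p \<in> B \<and> q \<in> B \<and> r \<in> A - B"
      | "p \<in> A \<and> r \<in> A \<and> q \<in> B - A \<or> p \<in> B \<and> r \<in> B \<and> q \<in> A - B"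
      | "q \<in> A \<and> r \<in> A \<and> p \<in> B - A \<or> q \<in> B \<and> r \<in> B \<and> p \<in> A - B"
      using pqr by blast
    then show "\<exists>f. colouring E m (A \<union> B) f \<and> two_valued f p q r"
    proof cases
      case 1
      then show ?thesis
        using flexible_two_valued[OF A, of p q r] extendA stable unfolding two_valued_def by metis
    next
      case 2
      then show ?thesis
        using flexible_two_valued[OF B, of p q r] extendB stable unfolding two_valued_def by metis
    next
      case 3
      then show ?thesis using across stable by blast
    next
      case 4
      then obtain f where "colouring E m (A \<union> B) f" "two_valued f p r q"
        using across[of p r q] stable by blast
      then show ?thesis using two_valued_perm(2) by metis
    next
      case 5
      then obtain f where "colouring E m (A \<union> B) f" "two_valued f q r p"
        using across[of q r p] stable by blast
      then show ?thesis using two_valued_perm(1)[OF two_valued_perm(2)] by metis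
    qed
  qed
qed

end

section \<open>Separations from failing 3-connectivity, and the induction\<close>

text \<open>A cutset of at most two vertices is padded to exactly two, sparing two vertices
  \<open>u\<close>, \<open>v\<close> that it separates. The component of \<open>u\<close> together
  with the padded cut forms one side.\<close>

lemma separation_if_not_3_connected:
  assumes "sym E" "finite W" "4 \<le> card W" "\<not> k_connected 3 W (E \<inter> W \<times> W)"
  obtains A B x y where "A \<union> B = W" "A \<inter> B = {x, y}" "x \<noteq> y" "A - B \<noteq> {}" "B - A \<noteq> {}"
    "\<And>u v. u \<in> A - B \<Longrightarrow> v \<in> B - A \<Longrightarrow> (u, v) \<notin> E"
proof -
  obtain S where S: "S \<subseteq> W" "card S \<le> 2" and "\<not> connected_graph (W - S) (E \<inter> W \<times> W)"
    using assms unfolding k_connected_def vertex_cutset_def by auto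
  moreover define R where "R = E \<inter> W \<times> W \<inter> (W - S) \<times> (W - S)"
  ultimately obtain u v where uv: "u \<in> W - S" "v \<in> W - S" "(u, v) \<notin> R\<^sup>*"
    unfolding connected_graph_def by blast
  then have "u \<noteq> v" by blast
  have finS: "finite S" using S assms finite_subset by blast
  have "card (W - S - {u, v}) = card W - card S - 2"
    using uv \<open>u \<noteq> v\<close> S finS assms(2) by (simp add: card_Diff_subset)
  \<comment> \<open>With at least four vertices in \<open>W\<close>, enough remain outside
    \<open>S\<close> and \<open>{u, v}\<close> for the padding.\<close>
  then have "2 - card S \<le> card (W - S - {u, v})" using assms(3) by linarith
  then obtain Y where Y: "Y \<subseteq> W - S - {u, v}" "card Y = 2 - card S"
    by (rule obtain_subset_with_card_n)
  have "finite Y" using Y assms(2) by (meson finite_Diff finite_subset)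
  then have "card (S \<union> Y) = 2"
    using Y S finS card_Un_disjoint[of S Y] by auto
  then obtain x y where xy: "S \<union> Y = {x, y}" "x \<noteq> y" by (meson card_2_iff)
  \<comment> \<open>\<open>C\<close> may meet \<open>Y\<close>; this is harmless because the padded
    cut is put into both sides.\<close>
  define C where "C = {w \<in> W - S. (u, w) \<in> R\<^sup>*}"
  define A where "A = C \<union> (S \<union> Y)"
  define B where "B = (W - C) \<union> (S \<union> Y)"
  have "(a, b) \<notin> E" if "a \<in> A - B" "b \<in> B - A" for a b
  proof
    assume "(a, b) \<in> E"
    moreover have "a \<in> C" "b \<in> W - S" using that unfolding A_def B_def by blast+
    ultimately have "(a, b) \<in> R" unfolding R_def C_def by blast
    then have "b \<in> C"
      using \<open>a \<in> C\<close> \<open>b \<in> W - S\<close> unfolding C_def by (auto intro: rtrancl_into_rtrancl)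
    then show False using that unfolding A_def by blast
  qed
  moreover have "A \<union> B = W" using S Y unfolding A_def B_def C_def by blast
  moreover have "A \<inter> B = {x, y}" using xy unfolding A_def B_def by blast
  moreover have "u \<in> A - B" using uv Y unfolding A_def B_def C_def by blast
  moreover have "v \<in> B - A" using uv Y unfolding A_def B_def C_def by blast
  ultimately show ?thesis using that xy(2) by blast
qed

text \<open>Induction on proper subsets: if \<open>m - 1\<close> colours do not suffice,
  \<open>W\<close> splits into two smaller sides, which inherit the hypothesis because it ranges
  over all subsets.\<close>

lemma flexible_if_3_connected_colourable:
  assumes "sym E" "irrefl E" "4 \<le> m" "finite W"
    and "\<And>U. U \<subseteq> W \<Longrightarrow> k_connected 3 U (E \<inter> U \<times> U) \<Longrightarrow> \<exists>f. colouring E (m - 1) U f"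
  shows "flexible E m W"
  using assms(4,5)
proof (induction W rule: finite_psubset_induct)
  case (psubset W)
  show ?case
  proof (cases "\<exists>f. colouring E (m - 1) W f")
    case True
    then show ?thesis using flexible_if_fewer_colours[OF assms(1,2)] assms(3) by auto
  next
    case no_col: False
    \<comment> \<open>Numbering at most three vertices injectively is already a proper colouring
      with \<open>m - 1 \<ge> 3\<close> colours.\<close>
    have "4 \<le> card W"
    proof (rule ccontr)
      assume "\<not> 4 \<le> card W"
      obtain f where f: "bij_betw f W {0..<card W}"
        using ex_bij_betw_finite_nat[OF psubset.hyps(1)] by blast
      have "f v < m - 1" if "v \<in> W" for v
      proof -
        have "f v \<in> {0..<card W}" using f that by (auto simp: bij_betw_def)
        then show ?thesis using \<open>\<not> 4 \<le> card W\<close> assms(3) by simp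
      qed
      moreover have "f u \<noteq> f v" if "u \<in> W" "v \<in> W" "(u, v) \<in> E" for u v
        using f that assms(2) unfolding bij_betw_def irrefl_def by (metis inj_onD)
      ultimately show False using no_col unfolding colouring_def by blast
    qed
    moreover have "\<not> k_connected 3 W (E \<inter> W \<times> W)" using no_col psubset.prems by blast
    ultimately obtain A B x y where sep: "A \<union> B = W" "A \<inter> B = {x, y}" "x \<noteq> y"
      "A - B \<noteq> {}" "B - A \<noteq> {}" "\<And>u v. u \<in> A - B \<Longrightarrow> v \<in> B - A \<Longrightarrow> (u, v) \<notin> E"
      using separation_if_not_3_connected[OF assms(1) psubset.hyps(1)] by metis
    interpret separation E m A B x y
      by unfold_locales (fact assms sep)+
    \<comment> \<open>A copy of K4 is 3-connected, so it is coloured with \<open>m - 1\<close>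
      colours; its four vertices need different ones, whence \<open>5 \<le> m\<close>.\<close>
    have "5 \<le> m" if U: "{a, b, c, d} \<subseteq> A \<union> B"
      and adj: "(a, b) \<in> E" "(a, c) \<in> E" "(a, d) \<in> E" "(b, c) \<in> E" "(b, d) \<in> E" "(c, d) \<in> E"
    for a b c d
    proof -
      define U where "U = {a, b, c, d}"
      have adj': "(u, v) \<in> E" if "u \<in> U" "v \<in> U" "u \<noteq> v" for u v
        using that adj assms(1) unfolding U_def by (auto dest: symD)
      have "distinct [a, b, c, d]" using adj assms(2) unfolding irrefl_def by auto
      then have card: "card U = 4" unfolding U_def by simp
      have "connected_graph (U - S) (E \<inter> U \<times> U)" for S
        unfolding connected_graph_def using adj' by (metis (no_types, lifting) DiffD1 IntI SigmaI r_into_rtrancl rtrancl.rtrancl_refl)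
      then have "k_connected 3 U (E \<inter> U \<times> U)"
        using card unfolding k_connected_def vertex_cutset_def by simp
      then obtain f where f: "colouring E (m - 1) U f"
        using psubset.prems[of U] U sep(1) unfolding U_def by blast
      have "inj_on f U" using adj' colouring_neq[OF f] unfolding inj_on_def by blast
      moreover have "f ` U \<subseteq> {..<m - 1}" using colouring_less[OF f] by auto
      ultimately have "card U \<le> card {..<m - 1}" by (intro card_inj_on_le) auto
      then show "5 \<le> m" using card by simp
    qed
    moreover have "flexible E m A" "flexible E m B"
      using psubset.IH[of A] psubset.IH[of B] psubset.prems sep by blast+
    ultimately show ?thesis using flexible_Un sep(1) by blast
  qed
qed

section \<open>Chromatic number and conclusion\<close>

lemma colourable_iff_colouring:
  assumes "graph V E"
  shows "colourable V E k \<longleftrightarrow> (\<exists>f. colouring E k V f)"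
proof -
  have "(\<forall>(u, v)\<in>E. f u \<noteq> f v) \<longleftrightarrow> (\<forall>u\<in>V. \<forall>v\<in>V. (u, v) \<in> E \<longrightarrow> f u \<noteq> f v)" for f :: "'a \<Rightarrow> nat"
    using assms unfolding graph_def by blast
  then show ?thesis unfolding colourable_def colouring_def by simp
qed

lemma chromatic_number_le_iff:
  assumes "graph V E"
  shows "chromatic_number V E \<le> k \<longleftrightarrow> colourable V E k"
proof
  \<comment> \<open>Numbering the finitely many vertices gives some colouring, so the
    \<open>LEAST\<close> is attained.\<close>
  obtain f and n :: nat where f: "inj_on f V" "f ` V = {i. i < n}"
    using finite_imp_inj_to_nat_seg assms unfolding graph_def by metis
  have "f v < n" if "v \<in> V" for v
    using f(2) that by blast
  moreover have "f u \<noteq> f v" if "(u, v) \<in> E" for u v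
    using f(1) that assms unfolding graph_def irrefl_def by (metis inj_onD mem_Sigma_iff subsetD)
  ultimately have "colourable V E n" unfolding colourable_def by blast
  then have "colourable V E (chromatic_number V E)"
    unfolding chromatic_number_def by (rule LeastI)
  moreover assume "chromatic_number V E \<le> k"
  ultimately show "colourable V E k"
    unfolding colourable_def by (meson order_less_le_trans)
next
  assume "colourable V E k"
  then show "chromatic_number V E \<le> k"
    unfolding chromatic_number_def by (rule Least_le)
qed

text \<open>Common core of both claims. Induced subgraphs are subgraphs, so \<open>V\<close> is
  flexible, and a single vertex taken twice in the first flexibility property yields a
  colouring.\<close>

lemma colourable_if_3_connected_colourable:
  assumes "4 \<le> m" "graph V E"
    and sub: "\<And>U F. subgraph U F V E \<Longrightarrow> k_connected 3 U F \<Longrightarrow> colourable U F (m - 1)"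
  shows "colourable V E m"
proof -
  have "\<exists>f. colouring E (m - 1) U f" if "U \<subseteq> V" "k_connected 3 U (E \<inter> U \<times> U)" for U
  proof -
    have "graph U (E \<inter> U \<times> U)"
      using assms(2) that(1) finite_subset unfolding graph_def sym_def irrefl_def by blast
    then have "subgraph U (E \<inter> U \<times> U) V E" using that(1) unfolding subgraph_def by blast
    then have "colourable U (E \<inter> U \<times> U) (m - 1)" using sub that(2) by blast
    then show ?thesis unfolding colourable_def colouring_def by blast
  qed
  then have flex: "flexible E m V"
    using assms(1,2) unfolding graph_def by (intro flexible_if_3_connected_colourable) auto
  have "\<exists>f. colouring E m V f"
  proof (cases "V = {}")
    case True
    then show ?thesis by (simp add: colouring_def)
  next
    case False
    then obtain u where "u \<in> V" by blast
    moreover have "(u, u) \<notin> E" using assms(2) by (simp add: graph_def irrefl_def)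
    ultimately show ?thesis using flexible_eq[OF flex] by metis
  qed
  then show ?thesis using colourable_iff_colouring[OF assms(2)] by blast
qed

theorem theorem2:
  shows "(\<forall>(m::nat) (V::'a set) E. m \<ge> 4 \<and> graph V E \<and> chromatic_number V E \<ge> m + 1 \<longrightarrow>
            (\<exists>V' E'. subgraph V' E' V E \<and> k_connected 3 V' E' \<and> chromatic_number V' E' \<ge> m))
       \<and> (\<forall>(V::'a set) E. graph V E \<and> fragile V E \<longrightarrow> colourable V E 4)"
proof (intro conjI allI impI)
  fix m :: nat and V :: "'a set" and E
  assume *: "m \<ge> 4 \<and> graph V E \<and> chromatic_number V E \<ge> m + 1"
  show "\<exists>V' E'. subgraph V' E' V E \<and> k_connected 3 V' E' \<and> chromatic_number V' E' \<ge> m"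
  proof (rule ccontr)
    assume no: "\<not> ?thesis"
    have "colourable U F (m - 1)" if "subgraph U F V E" "k_connected 3 U F" for U F
    proof -
      have "chromatic_number U F \<le> m - 1" using no that by fastforce
      then show ?thesis using chromatic_number_le_iff that(1) unfolding subgraph_def by blast
    qed
    then have "colourable V E m"
      using * colourable_if_3_connected_colourable[of m V E] by blast
    then show False using * chromatic_number_le_iff[of V E m] by auto
  qed
next
  fix V :: "'a set" and E
  assume "graph V E \<and> fragile V E"
  \<comment> \<open>With \<open>m = 4\<close> the hypothesis on 3-connected subgraphs holds
    vacuously.\<close>
  then show "colourable V E 4"
    using colourable_if_3_connected_colourable[of 4 V E] unfolding fragile_def by blast
qed

end
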